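(* Let $\ell\ge2$ be an integer and let $G$ be a graph with at least one edge. The following hold: (i) If $\chi(G)\ge3$, then for every $k\in\{3,4,\dots,\chi(G)\}$ there exists a $\mathbb{Z}_\ell$-voltage assignment $\alpha$ on $G$ such that $\chi(\widetilde G(\alpha,\ell))=k$. (ii) There exists a $\mathbb{Z}_\ell$-voltage assignment $\alpha$ on $G$ such that $\chi(\widetilde G(\alpha,\ell))=2$ if and only if either $G$ is bipartite or $\ell$ is even.
   Context: All graphs are finite and loopless, but may have parallel edges. $\chi(G)$ is the (vertex) chromatic number of $G$. Fix an arbitrary reference orientation of $G$; each edge $e$ has a tail $t(e)$ and a head $h(e)$. $\mathbb{Z}_\ell$ is the additive cyclic group of residues modulo $\ell$. A $\mathbb{Z}_\ell$-voltage assignment on $G$ is a function $\alpha:E(G)\to\mathbb{Z}_\ell$. The $\ell$-fold cyclic cover $\widetilde G(\alpha,\ell)$ of $G$ derived from $\alpha$ is the graph with vertex set $V(G)\times\mathbb{Z}_\ell$ and edge set $E(G)\times\mathbb{Z}_\ell$, where the edge $(e,i)$ joins $(t(e),i)$ and $(h(e),i+\alpha(e))$. *)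

theory Defs
  imports "Graph_Theory.Digraph" "HOL-Algebra.Elementary_Groups"
begin

text \<open>
  A finite loopless graph, possibly with parallel edges, together with an arbitrary
  reference orientation: each edge is an arc, and a single arc (not a symmetric pair) stands
  for one undirected edge.  Adjacency, colourings and bipartiteness below ignore
  the orientation.
\<close>
locale loopless_multigraph = fin_digraph G + loopfree_digraph G
  for G :: "('a, 'b) pre_digraph" (structure)

definition proper_colouring :: "('a, 'b) pre_digraph \<Rightarrow> nat \<Rightarrow> ('a \<Rightarrow> nat) \<Rightarrow> bool" where
  "proper_colouring G k c \<longleftrightarrow>
     c ` verts G \<subseteq> {..<k} \<and> (\<forall>e\<in>arcs G. c (tail G e) \<noteq> c (head G e))"

definition colourable :: "('a, 'b) pre_digraph \<Rightarrow> nat \<Rightarrow> bool" where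
  "colourable G k \<longleftrightarrow> (\<exists>c. proper_colouring G k c)"

definition chromatic_number :: "('a, 'b) pre_digraph \<Rightarrow> nat" where
  "chromatic_number G = (LEAST k. colourable G k)"

definition bipartite :: "('a, 'b) pre_digraph \<Rightarrow> bool" where
  "bipartite G \<longleftrightarrow>
     (\<exists>A B. A \<union> B = verts G \<and> A \<inter> B = {} \<and>
       (\<forall>e\<in>arcs G. (tail G e \<in> A \<and> head G e \<in> B) \<or> (tail G e \<in> B \<and> head G e \<in> A)))"

text \<open>
  For \<open>l > 0\<close>, \<open>integer_mod_group l\<close> is the additive group of residues modulo \<open>l\<close>, with
  carrier \<open>{0..<int l}\<close>; HOL-Algebra writes its operation multiplicatively.
\<close>
definition voltage_assignment :: "nat \<Rightarrow> ('a, 'b) pre_digraph \<Rightarrow> ('b \<Rightarrow> int) \<Rightarrow> bool" where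
  "voltage_assignment l G \<alpha> \<longleftrightarrow> (\<forall>e\<in>arcs G. \<alpha> e \<in> carrier (integer_mod_group l))"

definition cyclic_cover ::
    "('a, 'b) pre_digraph \<Rightarrow> ('b \<Rightarrow> int) \<Rightarrow> nat \<Rightarrow> ('a \<times> int, 'b \<times> int) pre_digraph" where
  "cyclic_cover G \<alpha> l =
     \<lparr>verts = verts G \<times> carrier (integer_mod_group l),
      arcs = arcs G \<times> carrier (integer_mod_group l),
      tail = (\<lambda>(e, i). (tail G e, i)),
      head = (\<lambda>(e, i). (head G e, i \<otimes>\<^bsub>integer_mod_group l\<^esub> \<alpha> e))\<rparr>"

lemma (in loopless_multigraph) colourable_chromatic_number:
  "colourable G (chromatic_number G)"
proof -
  obtain c :: "'a \<Rightarrow> nat" where c: "bij_betw c (verts G) {0..<card (verts G)}"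
    using ex_bij_betw_finite_nat[OF finite_verts] by blast
  have "c (tail G e) \<noteq> c (head G e)" if "e \<in> arcs G" for e
    using that c no_loops[OF that] tail_in_verts[OF that] head_in_verts[OF that]
    by (auto simp: bij_betw_def inj_on_def)
  then have "proper_colouring G (card (verts G)) c"
    using c by (auto simp: proper_colouring_def bij_betw_def)
  then have "colourable G (card (verts G))"
    by (auto simp: colourable_def)
  then show ?thesis
    unfolding chromatic_number_def by (rule LeastI)
qed

lemma (in loopless_multigraph) loopless_multigraph_cyclic_cover:
  assumes "l > 0" "voltage_assignment l G \<alpha>"
  shows "loopless_multigraph (cyclic_cover G \<alpha> l)"
proof unfold_locales
  interpret Z: group "integer_mod_group l" by simp
  have fin: "finite (carrier (integer_mod_group l))"
    using assms(1) by (simp add: carrier_integer_mod_group)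
  show "finite (verts (cyclic_cover G \<alpha> l))" "finite (arcs (cyclic_cover G \<alpha> l))"
    using fin by (simp_all add: cyclic_cover_def)
  fix e assume e: "e \<in> arcs (cyclic_cover G \<alpha> l)"
  obtain a i where ai: "e = (a, i)" by (cases e)
  have a: "a \<in> arcs G" and i: "i \<in> carrier (integer_mod_group l)"
    using e by (auto simp: cyclic_cover_def ai)
  have \<alpha>: "\<alpha> a \<in> carrier (integer_mod_group l)"
    using a assms(2) by (simp add: voltage_assignment_def)
  show "tail (cyclic_cover G \<alpha> l) e \<in> verts (cyclic_cover G \<alpha> l)"
    using a i by (simp add: cyclic_cover_def ai)
  show "head (cyclic_cover G \<alpha> l) e \<in> verts (cyclic_cover G \<alpha> l)"
    using a Z.m_closed[OF i \<alpha>] by (simp add: cyclic_cover_def ai del: mult_integer_mod_group)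
  show "tail (cyclic_cover G \<alpha> l) e \<noteq> head (cyclic_cover G \<alpha> l) e"
    using no_loops[OF a] by (simp add: cyclic_cover_def ai)
qed

end

theory Submission
  imports Defs
begin

text \<open>
  Both parts rest on the all-ones assignment. Sending \<open>(v, i)\<close> to \<open>i\<close> maps its cover
  homomorphically to the cycle on the residues modulo \<open>l\<close>, so this cover is 3-colourable, and
  2-colourable when \<open>l\<close> is even. The zero assignment, at the other extreme, gives disjoint copies
  of \<open>G\<close> and hence chromatic number \<open>\<chi>(G)\<close>.

  The values between are reached by a discrete continuity argument. Two assignments that
  differ only on edges at one vertex \<open>v\<close> have covers that coincide away from the fibre of \<open>v\<close>.
  As \<open>G\<close> has no loops, this fibre is independent, so a single new colour for it suffices
  (\<open>colourable_cover_change_at_vertex\<close>). Changing one assignment into another vertex by vertex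
  therefore never skips a chromatic number (\<open>chromatic_number_cover_interpolation\<close>).

  If \<open>l\<close> is odd and the cover has a 2-colouring \<open>c\<close> with colours 0 and 1, then along every edge
  of \<open>G\<close> the matching between the two fibres exchanges the colours, so the two fibre
  sums of \<open>c\<close> add up to the odd number \<open>l\<close>. The parity of the fibre sum is thus a 2-colouring of \<open>G\<close>
  (\<open>colourable_2_if_odd_cover_colourable_2\<close>). Conversely, a bipartition lifts to every cover.
\<close>

section \<open>Colourability and the chromatic number\<close>

lemma colourable_mono:
  assumes "colourable G k" "k \<le> m"
  shows "colourable G m"
  using assms unfolding colourable_def proper_colouring_def
  by (metis lessThan_subset_iff subset_trans)

lemma (in loopless_multigraph) chromatic_number_le_iff:
  "chromatic_number G \<le> k \<longleftrightarrow> colourable G k"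
proof
  show "chromatic_number G \<le> k \<Longrightarrow> colourable G k"
    using colourable_mono colourable_chromatic_number by blast
  show "colourable G k \<Longrightarrow> chromatic_number G \<le> k"
    unfolding chromatic_number_def by (rule Least_le)
qed

lemma (in loopless_multigraph) chromatic_number_ge_2:
  assumes "arcs G \<noteq> {}"
  shows "chromatic_number G \<ge> 2"
proof (rule ccontr)
  assume "\<not> chromatic_number G \<ge> 2"
  then have "colourable G 1"
    using chromatic_number_le_iff[of 1] by simp
  then obtain c :: "'a \<Rightarrow> nat" where c: "c ` verts G \<subseteq> {..<1}"
    "\<forall>e\<in>arcs G. c (tail G e) \<noteq> c (head G e)"
    unfolding colourable_def proper_colouring_def by blast
  obtain e where e: "e \<in> arcs G"
    using assms by blast
  have "c (tail G e) = 0" "c (head G e) = 0"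
    using c(1) tail_in_verts[OF e] head_in_verts[OF e] by auto
  with c(2) e show False
    by metis
qed

lemma (in loopless_multigraph) bipartite_iff_colourable_2:
  "bipartite G \<longleftrightarrow> colourable G 2"
proof
  assume "bipartite G"
  then obtain A B where AB: "A \<inter> B = {}"
    "\<forall>e\<in>arcs G. (tail G e \<in> A \<and> head G e \<in> B) \<or> (tail G e \<in> B \<and> head G e \<in> A)"
    by (auto simp: bipartite_def)
  then have "proper_colouring G 2 (\<lambda>v. if v \<in> A then 0 else 1)"
    by (auto simp: proper_colouring_def)
  then show "colourable G 2"
    by (auto simp: colourable_def)
next
  assume "colourable G 2"
  then obtain c :: "'a \<Rightarrow> nat" where c: "c ` verts G \<subseteq> {..<2}"
    "\<forall>e\<in>arcs G. c (tail G e) \<noteq> c (head G e)"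
    by (auto simp: colourable_def proper_colouring_def)
  have val: "c v = 0 \<or> c v = 1" if "v \<in> verts G" for v
    using c(1) that by force
  show "bipartite G"
    unfolding bipartite_def
  proof (intro exI conjI ballI)
    show "{v\<in>verts G. c v = 0} \<union> {v\<in>verts G. c v = 1} = verts G"
      using val by auto
    show "{v\<in>verts G. c v = 0} \<inter> {v\<in>verts G. c v = 1} = {}"
      by auto
    fix e assume "e \<in> arcs G"
    then show "tail G e \<in> {v\<in>verts G. c v = 0} \<and> head G e \<in> {v\<in>verts G. c v = 1} \<or>
        tail G e \<in> {v\<in>verts G. c v = 1} \<and> head G e \<in> {v\<in>verts G. c v = 0}"
      using c(2) val[of "tail G e"] val[of "head G e"] by auto
  qed
qed

section \<open>Colourings of cyclic covers\<close>

lemma proper_colouring_cyclic_cover_iff: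
  assumes "l > 0"
  shows "proper_colouring (cyclic_cover G \<alpha> l) k c \<longleftrightarrow>
    (\<forall>v\<in>verts G. \<forall>i\<in>{0..<int l}. c (v, i) < k) \<and>
    (\<forall>e\<in>arcs G. \<forall>i\<in>{0..<int l}. c (tail G e, i) \<noteq> c (head G e, (i + \<alpha> e) mod int l))"
  using assms
  by (auto simp: proper_colouring_def cyclic_cover_def carrier_integer_mod_group
      mult_integer_mod_group image_subset_iff)

lemma colourable_cyclic_cover_cong:
  assumes "l > 0" "\<And>e. e \<in> arcs G \<Longrightarrow> \<alpha> e = \<beta> e"
  shows "colourable (cyclic_cover G \<alpha> l) k \<longleftrightarrow> colourable (cyclic_cover G \<beta> l) k"
  using assms by (simp add: colourable_def proper_colouring_cyclic_cover_iff)

text \<open>Composing a colouring of \<open>G\<close> with the covering projection.\<close>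

lemma (in loopless_multigraph) colourable_cyclic_cover:
  assumes "l > 0" "colourable G k"
  shows "colourable (cyclic_cover G \<alpha> l) k"
proof -
  obtain c where "proper_colouring G k c"
    using assms(2) by (auto simp: colourable_def)
  then have "proper_colouring (cyclic_cover G \<alpha> l) k (c \<circ> fst)"
    unfolding proper_colouring_cyclic_cover_iff[OF assms(1)] by (auto simp: proper_colouring_def)
  then show ?thesis
    by (auto simp: colourable_def)
qed

text \<open>Each sheet of the cover for the zero assignment is a copy of \<open>G\<close>; sheet 0 is used.\<close>

lemma (in loopless_multigraph) colourable_cyclic_cover_zero_iff:
  assumes "l > 0"
  shows "colourable (cyclic_cover G (\<lambda>_. 0) l) k \<longleftrightarrow> colourable G k"
proof
  assume "colourable (cyclic_cover G (\<lambda>_. 0) l) k"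
  then obtain c where "proper_colouring (cyclic_cover G (\<lambda>_. 0) l) k c"
    by (auto simp: colourable_def)
  then have "proper_colouring G k (\<lambda>v. c (v, 0))"
    using assms unfolding proper_colouring_cyclic_cover_iff[OF assms]
    by (auto simp: proper_colouring_def)
  then show "colourable G k"
    by (auto simp: colourable_def)
qed (use assms colourable_cyclic_cover in blast)

text \<open>
  The homomorphism \<open>(v, i) \<mapsto> i\<close> to the cycle on the residues pulls a colouring \<open>f\<close> of this
  cycle back to the cover.
\<close>

lemma colourable_cover_one_if_cycle_colouring:
  assumes "l > 0"
    and "\<And>i. 0 \<le> i \<Longrightarrow> i < int l \<Longrightarrow> f i < k \<and> f i \<noteq> f ((i + 1) mod int l)"
  shows "colourable (cyclic_cover G (\<lambda>_. 1) l) k"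
proof -
  have "proper_colouring (cyclic_cover G (\<lambda>_. 1) l) k (f \<circ> snd)"
    using assms by (simp add: proper_colouring_cyclic_cover_iff)
  then show ?thesis
    by (auto simp: colourable_def)
qed

lemma succ_mod_eq:
  assumes "0 \<le> i" "i < int l"
  shows "(i + 1) mod int l = (if i = int l - 1 then 0 else i + 1)"
  using assms by simp

lemma colourable_2_cover_one:
  assumes "l > 0" "even l"
  shows "colourable (cyclic_cover G (\<lambda>_. 1) l) 2"
proof (rule colourable_cover_one_if_cycle_colouring[where f = "\<lambda>i. if even i then 0 else 1"])
  fix i assume "0 \<le> i" "i < int l"
  then show "(if even i then 0 else 1) < (2::nat) \<and>
      (if even i then 0 else 1) \<noteq> (if even ((i + 1) mod int l) then 0 else 1 :: nat)"
    using assms(2) by (auto simp: succ_mod_eq)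
qed (fact assms(1))

text \<open>
  The colours alternate along the cycle, except that the last residue \<open>l - 1\<close> gets the third
  colour; \<open>l \<ge> 2\<close> ensures that it is not adjacent to itself.
\<close>

lemma colourable_3_cover_one:
  assumes "l \<ge> 2"
  shows "colourable (cyclic_cover G (\<lambda>_. 1) l) 3"
proof (rule colourable_cover_one_if_cycle_colouring
    [where f = "\<lambda>i. if i = int l - 1 then 2 else if even i then 0 else 1"])
  fix i assume "0 \<le> i" "i < int l"
  then show "(if i = int l - 1 then 2 else if even i then 0 else 1) < (3::nat) \<and>
      (if i = int l - 1 then 2 else if even i then 0 else 1) \<noteq>
      (if (i + 1) mod int l = int l - 1 then 2
       else if even ((i + 1) mod int l) then 0 else 1 :: nat)"
    using assms by (auto simp: succ_mod_eq)
qed (use assms in simp)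

section \<open>Two-colourable covers with an odd number of sheets\<close>

lemma bij_betw_add_mod:
  assumes "l > 0"
  shows "bij_betw (\<lambda>i. (i + a) mod int l) {0..<int l} {0..<int l}"
proof (rule bij_betw_byWitness[where f' = "\<lambda>i. (i - a) mod int l"])
  show "\<forall>i\<in>{0..<int l}. ((i + a) mod int l - a) mod int l = i"
    by (simp add: mod_diff_left_eq)
  show "\<forall>i\<in>{0..<int l}. ((i - a) mod int l + a) mod int l = i"
    by (simp add: mod_add_left_eq)
qed (use assms in auto)

text \<open>
  Translation by \<open>\<alpha> e\<close> permutes the fibre over the head of \<open>e\<close>, so the colours of the \<open>l\<close>
  lifts' ends, one pair \<open>{0, 1}\<close> per lift, sum to \<open>l\<close>. An odd \<open>l\<close> forces the fibre sums at the
  two ends of \<open>e\<close> to have different parities.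
\<close>

lemma colourable_2_if_odd_cover_colourable_2:
  assumes "odd l" "wf_digraph G" "colourable (cyclic_cover G \<alpha> l) 2"
  shows "colourable G 2"
proof -
  interpret wf_digraph G by fact
  have l: "l > 0"
    using assms(1) by (rule odd_pos)
  obtain c where "proper_colouring (cyclic_cover G \<alpha> l) 2 c"
    using assms(3) by (auto simp: colourable_def)
  then have lt: "\<And>v i. v \<in> verts G \<Longrightarrow> i \<in> {0..<int l} \<Longrightarrow> c (v, i) < 2"
    and neq: "\<And>e i. e \<in> arcs G \<Longrightarrow> i \<in> {0..<int l} \<Longrightarrow>
      c (tail G e, i) \<noteq> c (head G e, (i + \<alpha> e) mod int l)"
    using l by (auto simp: proper_colouring_cyclic_cover_iff)
  define s where "s v = (\<Sum>i\<in>{0..<int l}. c (v, i))" for v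
  have parity: "s (tail G e) mod 2 \<noteq> s (head G e) mod 2" if e: "e \<in> arcs G" for e
  proof -
    have "s (head G e) = (\<Sum>i\<in>{0..<int l}. c (head G e, (i + \<alpha> e) mod int l))"
      unfolding s_def
      by (rule sum.reindex_bij_betw[OF bij_betw_add_mod[OF l], symmetric])
    then have "s (tail G e) + s (head G e) =
        (\<Sum>i\<in>{0..<int l}. c (tail G e, i) + c (head G e, (i + \<alpha> e) mod int l))"
      by (simp add: s_def sum.distrib)
    also have "\<dots> = (\<Sum>i\<in>{0..<int l}. 1)"
    proof (rule sum.cong)
      fix i assume i: "i \<in> {0..<int l}"
      then have "(i + \<alpha> e) mod int l \<in> {0..<int l}"
        using l by simp
      then show "c (tail G e, i) + c (head G e, (i + \<alpha> e) mod int l) = 1"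
        using lt[OF tail_in_verts[OF e] i] lt[OF head_in_verts[OF e]] neq[OF e i] by fastforce
    qed simp
    also have "\<dots> = l"
      by simp
    finally have "odd (s (tail G e) + s (head G e))"
      using assms(1) by simp
    then show ?thesis
      by presburger
  qed
  then have "proper_colouring G 2 (\<lambda>v. s v mod 2)"
    by (auto simp: proper_colouring_def)
  then show ?thesis
    by (auto simp: colourable_def)
qed

section \<open>Interpolation between voltage assignments\<close>

text \<open>The fibre of \<open>v\<close>, an independent set, receives the new colour \<open>k\<close>.\<close>

lemma (in loopless_multigraph) colourable_cover_change_at_vertex:
  assumes "l > 0" "colourable (cyclic_cover G \<alpha> l) k"
    and agree: "\<And>e. e \<in> arcs G \<Longrightarrow> tail G e \<noteq> v \<Longrightarrow> head G e \<noteq> v \<Longrightarrow> \<alpha> e = \<beta> e"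
  shows "colourable (cyclic_cover G \<beta> l) (Suc k)"
proof -
  obtain c where "proper_colouring (cyclic_cover G \<alpha> l) k c"
    using assms(2) by (auto simp: colourable_def)
  then have lt: "\<And>w i. w \<in> verts G \<Longrightarrow> i \<in> {0..<int l} \<Longrightarrow> c (w, i) < k"
    and neq: "\<And>e i. e \<in> arcs G \<Longrightarrow> i \<in> {0..<int l} \<Longrightarrow>
      c (tail G e, i) \<noteq> c (head G e, (i + \<alpha> e) mod int l)"
    using assms(1) by (auto simp: proper_colouring_cyclic_cover_iff)
  define d where "d = (\<lambda>(w, i). if w = v then k else c (w, i))"
  have "d (w, i) < Suc k" if "w \<in> verts G" "i \<in> {0..<int l}" for w i
    using lt[OF that] by (simp add: d_def)
  moreover have "d (tail G e, i) \<noteq> d (head G e, (i + \<beta> e) mod int l)"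
    if e: "e \<in> arcs G" and i: "i \<in> {0..<int l}" for e i
  proof -
    have "(i + \<beta> e) mod int l \<in> {0..<int l}"
      using assms(1) by simp
    then have "c (tail G e, i) < k" "c (head G e, (i + \<beta> e) mod int l) < k"
      using e i lt by auto
    then show ?thesis
      using neq[OF e i] agree[OF e] no_loops[OF e] by (auto simp: d_def)
  qed
  ultimately have "proper_colouring (cyclic_cover G \<beta> l) (Suc k) d"
    using assms(1) by (simp add: proper_colouring_cyclic_cover_iff)
  then show ?thesis
    by (auto simp: colourable_def)
qed

text \<open>
  Switching \<open>\<alpha>\<close> to \<open>\<beta>\<close> at one vertex at a time lowers the chromatic number by at most one per
  switch, so the first assignment on the way whose cover has chromatic number at most \<open>k\<close>
  attains \<open>k\<close> exactly.
\<close>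

lemma (in loopless_multigraph) chromatic_number_cover_interpolation:
  assumes l: "l > 0" and \<alpha>: "voltage_assignment l G \<alpha>" and \<beta>: "voltage_assignment l G \<beta>"
    and "chromatic_number (cyclic_cover G \<beta> l) \<le> k" "k \<le> chromatic_number (cyclic_cover G \<alpha> l)"
  shows "\<exists>\<gamma>. voltage_assignment l G \<gamma> \<and> chromatic_number (cyclic_cover G \<gamma> l) = k"
proof -
  \<comment> \<open>All edges at vertices of \<open>S\<close> have been switched from \<open>\<alpha>\<close> to \<open>\<beta>\<close>.\<close>
  define mix where
    "mix S = (\<lambda>e. if tail G e \<in> S \<or> head G e \<in> S then \<beta> e else \<alpha> e)" for S
  let ?\<chi> = "\<lambda>\<gamma>. chromatic_number (cyclic_cover G \<gamma> l)"
  have mix: "voltage_assignment l G (mix S)" for S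
    using \<alpha> \<beta> by (auto simp: voltage_assignment_def mix_def)
  have le_iff: "?\<chi> \<gamma> \<le> m \<longleftrightarrow> colourable (cyclic_cover G \<gamma> l) m"
    if "voltage_assignment l G \<gamma>" for \<gamma> m
    using loopless_multigraph.chromatic_number_le_iff[OF loopless_multigraph_cyclic_cover[OF l that]] .
  have step: "?\<chi> (mix S) \<le> Suc (?\<chi> (mix (insert v S)))" for v S
  proof -
    have "colourable (cyclic_cover G (mix (insert v S)) l) (?\<chi> (mix (insert v S)))"
      using le_iff[OF mix] by blast
    then have "colourable (cyclic_cover G (mix S) l) (Suc (?\<chi> (mix (insert v S))))"
      by (rule colourable_cover_change_at_vertex[OF l, where v = v]) (simp add: mix_def)
    then show ?thesis
      using le_iff[OF mix] by blast
  qed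
  have reach: "\<exists>\<gamma>. voltage_assignment l G \<gamma> \<and> ?\<chi> \<gamma> = k" if "finite S" "?\<chi> (mix S) \<le> k" for S
    using that
  proof (induction S rule: finite_induct)
    case empty
    have "mix {} = \<alpha>"
      by (simp add: mix_def)
    then show ?case
      using empty assms(5) \<alpha> by auto
  next
    case (insert v S)
    show ?case
    proof (cases "?\<chi> (mix S) \<le> k")
      case True
      then show ?thesis
        by (rule insert.IH)
    next
      case False
      then have "?\<chi> (mix (insert v S)) = k"
        using step[of S v] insert.prems by simp
      then show ?thesis
        using mix by blast
    qed
  qed
  have "colourable (cyclic_cover G \<beta> l) k"
    using assms(4) le_iff[OF \<beta>] by blast
  then have "colourable (cyclic_cover G (mix (verts G)) l) k"
    using colourable_cyclic_cover_cong[OF l, of G "mix (verts G)" \<beta>] by (simp add: mix_def)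
  then show ?thesis
    using reach[OF finite_verts] le_iff[OF mix] by blast
qed

section \<open>The chromatic numbers of cyclic covers\<close>

theorem theorem1p3:
  fixes l :: nat and G :: "('a, 'b) pre_digraph"
  assumes "l \<ge> 2"
    and "loopless_multigraph G"
    and "arcs G \<noteq> {}"
  shows "(chromatic_number G \<ge> 3 \<longrightarrow>
            (\<forall>k\<in>{3..chromatic_number G}.
               \<exists>\<alpha>. voltage_assignment l G \<alpha> \<and> chromatic_number (cyclic_cover G \<alpha> l) = k))
       \<and> ((\<exists>\<alpha>. voltage_assignment l G \<alpha> \<and> chromatic_number (cyclic_cover G \<alpha> l) = 2)
            \<longleftrightarrow> bipartite G \<or> even l)"
proof -
  interpret loopless_multigraph G by fact
  have l: "l > 0"
    using assms(1) by simp
  have zero: "voltage_assignment l G (\<lambda>_. 0)" and one: "voltage_assignment l G (\<lambda>_. 1)"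
    using assms(1) by (auto simp: voltage_assignment_def carrier_integer_mod_group)
  have le_iff: "chromatic_number (cyclic_cover G \<alpha> l) \<le> k \<longleftrightarrow> colourable (cyclic_cover G \<alpha> l) k"
    if "voltage_assignment l G \<alpha>" for \<alpha> k
    using loopless_multigraph.chromatic_number_le_iff[OF loopless_multigraph_cyclic_cover[OF l that]] .
  have ge_2: "chromatic_number (cyclic_cover G \<alpha> l) \<ge> 2" if "voltage_assignment l G \<alpha>" for \<alpha>
  proof (rule loopless_multigraph.chromatic_number_ge_2[OF loopless_multigraph_cyclic_cover[OF l that]])
    show "arcs (cyclic_cover G \<alpha> l) \<noteq> {}"
      using assms(3) l by (simp add: cyclic_cover_def carrier_integer_mod_group)
  qed
  have eq_2_iff: "chromatic_number (cyclic_cover G \<alpha> l) = 2 \<longleftrightarrow> colourable (cyclic_cover G \<alpha> l) 2"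
    if "voltage_assignment l G \<alpha>" for \<alpha>
    using le_iff[OF that, of 2] ge_2[OF that] by auto
  have "chromatic_number (cyclic_cover G (\<lambda>_. 0) l) = chromatic_number G"
    by (simp add: chromatic_number_def colourable_cyclic_cover_zero_iff[OF l])
  moreover have "chromatic_number (cyclic_cover G (\<lambda>_. 1) l) \<le> 3"
    using le_iff[OF one] colourable_3_cover_one[OF assms(1)] by blast
  ultimately have
    "\<exists>\<alpha>. voltage_assignment l G \<alpha> \<and> chromatic_number (cyclic_cover G \<alpha> l) = k"
    if "k \<in> {3..chromatic_number G}" for k
    using chromatic_number_cover_interpolation[OF l zero one, of k] that by simp
  moreover have "(\<exists>\<alpha>. voltage_assignment l G \<alpha> \<and> chromatic_number (cyclic_cover G \<alpha> l) = 2)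
      \<longleftrightarrow> bipartite G \<or> even l"
  proof
    assume "\<exists>\<alpha>. voltage_assignment l G \<alpha> \<and> chromatic_number (cyclic_cover G \<alpha> l) = 2"
    then obtain \<alpha> where "colourable (cyclic_cover G \<alpha> l) 2"
      using eq_2_iff by blast
    then show "bipartite G \<or> even l"
      using colourable_2_if_odd_cover_colourable_2 wf_digraph_axioms bipartite_iff_colourable_2
      by blast
  next
    assume "bipartite G \<or> even l"
    then show "\<exists>\<alpha>. voltage_assignment l G \<alpha> \<and> chromatic_number (cyclic_cover G \<alpha> l) = 2"
    proof
      assume "bipartite G"
      then have "colourable (cyclic_cover G (\<lambda>_. 0) l) 2"
        using colourable_cyclic_cover[OF l] bipartite_iff_colourable_2 by blast
      then show ?thesis
        using eq_2_iff[OF zero] zero by blast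
    next
      assume "even l"
      then show ?thesis
        using eq_2_iff[OF one] one colourable_2_cover_one[OF l] by blast
    qed
  qed
  ultimately show ?thesis
    by blast
qed

end
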